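(* Let $\Delta\geq 3$ be a fixed integer. For $n$ large enough that connected nonregular graphs on $n$ vertices with maximum degree $\Delta$ exist, let $\lambda_1(n,\Delta)$ denote the maximum of $\lambda_1(G)$ over all connected nonregular graphs $G$ on $n$ vertices with maximum degree $\Delta$. If $\Delta$ is odd, then \[ \limsup_{n\to\infty} \frac{n^2(\Delta-\lambda_1(n,\Delta))}{\Delta-1} \leq \frac{\pi^2}{4}. \] If $\Delta$ is even, then \[ \limsup_{n\to\infty} \frac{n^2(\Delta-\lambda_1(n,\Delta))}{\Delta-2} \leq \frac{\pi^2}{2}. \]
   Context: All graphs are finite, simple and undirected. $\lambda_1(G)$ denotes the largest eigenvalue (spectral radius) of the adjacency matrix of $G$. A graph is nonregular if not all its vertices have the same degree. *)

theory Defs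
  imports
    "HOL-Analysis.Analysis"
    "Graph_Theory.Graph_Theory"
    "Jordan_Normal_Form.Spectral_Radius"
begin

text \<open>
  A finite simple undirected graph is a \<open>pair_graph\<close>: a finite vertex set with a symmetric,
  irreflexive set of arcs, each undirected edge being represented by its two orientations.
  Hence the degree of a vertex is its out-degree.
  A graph on \<open>n\<close> vertices has, up to isomorphism, the vertex set \<open>{0..<n}\<close>.
\<close>

definition max_degree :: "'a pair_pre_digraph \<Rightarrow> nat" where
  "max_degree G = Max (out_degree (with_proj G) ` pverts G)"

definition regular_graph :: "'a pair_pre_digraph \<Rightarrow> bool" where
  "regular_graph G \<longleftrightarrow>
     (\<forall>u\<in>pverts G. \<forall>v\<in>pverts G. out_degree (with_proj G) u = out_degree (with_proj G) v)"

text \<open>The adjacency matrix and \<open>lambda1\<close> are meant for graphs with vertex set \<open>{0..<n}\<close>.\<close>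

definition adjacency_matrix :: "nat pair_pre_digraph \<Rightarrow> real mat" where
  "adjacency_matrix G =
     mat (card (pverts G)) (card (pverts G)) (\<lambda>(i, j). if (i, j) \<in> parcs G then 1 else 0)"

definition lambda1 :: "nat pair_pre_digraph \<Rightarrow> real" where
  "lambda1 G = Max (spectrum (adjacency_matrix G))"

definition connected_nonregular_graphs :: "nat \<Rightarrow> nat \<Rightarrow> nat pair_pre_digraph set" where
  "connected_nonregular_graphs n \<Delta> =
     {G. pair_graph G \<and> pverts G = {0..<n} \<and> Digraph_Component.connected (with_proj G) \<and>
         \<not> regular_graph G \<and> max_degree G = \<Delta>}"

text \<open>
  The family above is finite. When it is empty the value below is unspecified; for \<open>\<Delta> \<ge> 3\<close> this
  concerns only finitely many \<open>n\<close>, so it does not affect the limit superior.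
\<close>

definition lambda1_max :: "nat \<Rightarrow> nat \<Rightarrow> real" where
  "lambda1_max n \<Delta> = Max (lambda1 ` connected_nonregular_graphs n \<Delta>)"

end

theory Submission
  imports Defs
begin

text \<open>
  A test vector \<open>x\<close> on a suitable graph bounds \<open>\<lambda>\<^sub>1\<close> from below by a Rayleigh quotient. The graph is a
  chain of \<open>m\<close> blocks \<open>K\<^bsub>\<Delta>+1\<^esub>\<close>. In each block one vertex, the exit, is disconnected from \<open>c\<close> other
  vertices, the entries, and is joined instead to the entries of the next block. A cap in front
  of the first block makes all degrees there equal to \<open>\<Delta>\<close>; such a cap exists with
  \<open>c = 1\<close> if \<open>\<Delta>\<close> is odd, whereas for even \<open>\<Delta>\<close> the handshake lemma forces \<open>c \<ge> 2\<close>. A short path after the last block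
  makes the graph nonregular and adjusts the number of vertices.

  With edges as unit resistors, a block has resistance \<open>(\<Delta> + 1) / (c (\<Delta> - c))\<close>. The test vector
  is \<open>1\<close> on the cap, \<open>0\<close> on the path, \<open>cos (\<pi> j / (2 m))\<close> on the entries of block \<open>j\<close>, and harmonic
  in between. Since the values on the entries form a discrete eigenfunction, the quotient is at
  least \<open>\<Delta> - \<pi>\<^sup>2 c (\<Delta> - c) / (4 m\<^sup>2 (\<Delta> + 1)\<^sup>2)\<close>, where \<open>m (\<Delta> + 1)\<close> differs from \<open>n\<close> by a bounded amount.
\<close>

subsection \<open>Rayleigh quotients\<close>

text \<open>Setting all coordinates from \<open>n\<close> on to 0 makes the sphere a closed subset
  of a product of compact sets, so Tychonoff's theorem applies to the type
  \<open>nat \<Rightarrow> real\<close>.\<close>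

lemma quadratic_form_attains_max_on_sphere:
  fixes a :: "nat \<Rightarrow> nat \<Rightarrow> real"
  assumes "n > 0"
  defines "Q \<equiv> \<lambda>x. \<Sum>i<n. \<Sum>j<n. a i j * x i * x j"
  obtains v where "(\<Sum>i<n. (v i)\<^sup>2) = 1" "\<And>y. (\<Sum>i<n. (y i)\<^sup>2) = 1 \<Longrightarrow> Q y \<le> Q v"
proof -
  define B :: "nat \<Rightarrow> real set" where "B = (\<lambda>i. if i < n then {-1..1} else {0})"
  define S where "S = PiE UNIV B \<inter> {x. (\<Sum>i<n. (x i)\<^sup>2) = 1}"
  have "compact (PiE UNIV B)"
    using compactin_PiE[of "\<lambda>_. euclidean" UNIV B]
    by (simp add: B_def euclidean_product_topology)
  moreover have "closed {x :: nat \<Rightarrow> real. (\<Sum>i<n. (x i)\<^sup>2) = 1}"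
    by (intro closed_Collect_eq continuous_intros) auto
  ultimately have "compact S"
    unfolding S_def by (rule compact_Int_closed)
  moreover have "(\<lambda>i. if i = 0 then 1 else 0) \<in> S"
    using assms(1) by (auto simp: S_def B_def if_distrib [of "\<lambda>t. t\<^sup>2"] cong: if_cong)
  moreover have "continuous_on S Q"
    unfolding Q_def by (intro continuous_intros) (auto intro: continuous_on_product_then_coordinatewise)
  ultimately obtain v where v: "v \<in> S" "\<And>y. y \<in> S \<Longrightarrow> Q y \<le> Q v"
    using continuous_attains_sup[of S Q] by blast
  show thesis
  proof (rule that)
    show "(\<Sum>i<n. (v i)\<^sup>2) = 1"
      using v(1) by (simp add: S_def)
  next
    fix y :: "nat \<Rightarrow> real"
    assume y: "(\<Sum>i<n. (y i)\<^sup>2) = 1"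
    define y' where "y' = (\<lambda>i. if i < n then y i else 0)"
    have "\<bar>y i\<bar> \<le> 1" if "i < n" for i
    proof -
      have "(y i)\<^sup>2 \<le> (\<Sum>i<n. (y i)\<^sup>2)"
        using that by (intro member_le_sum) auto
      then show ?thesis
        using y by (simp add: abs_square_le_1)
    qed
    then have "y' \<in> S"
      using y by (auto simp: S_def B_def y'_def abs_le_iff minus_le_iff)
    then have "Q y' \<le> Q v"
      by (rule v(2))
    then show "Q y \<le> Q v"
      by (simp add: Q_def y'_def)
  qed
qed

text \<open>A maximiser \<open>v\<close> of the quadratic form on the sphere is an eigenvector for
  \<open>Q v\<close>: moving \<open>v\<close> along its residual \<open>g\<close> would otherwise
  increase the Rayleigh quotient.\<close>

lemma rayleigh_quotient_le_eigenvalue: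
  fixes a :: "nat \<Rightarrow> nat \<Rightarrow> real"
  assumes sym: "\<And>i j. i < n \<Longrightarrow> j < n \<Longrightarrow> a i j = a j i"
    and pos: "0 < (\<Sum>i<n. (x i)\<^sup>2)"
    and ge: "\<mu> * (\<Sum>i<n. (x i)\<^sup>2) \<le> (\<Sum>i<n. \<Sum>j<n. a i j * x i * x j)"
  obtains l v where "\<mu> \<le> l" "\<exists>i<n. v i \<noteq> 0" "\<And>i. i < n \<Longrightarrow> (\<Sum>j<n. a i j * v j) = l * v i"
proof -
  define Q where "Q = (\<lambda>x. \<Sum>i<n. \<Sum>j<n. a i j * x i * x j)"
  define N where "N = (\<lambda>x::nat\<Rightarrow>real. \<Sum>i<n. (x i)\<^sup>2)"
  have "n > 0"
    using pos by (cases n) auto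
  then obtain v where v: "N v = 1" and max: "\<And>y. N y = 1 \<Longrightarrow> Q y \<le> Q v"
    using quadratic_form_attains_max_on_sphere[of n a] unfolding Q_def N_def by blast
  have Nsmult: "N (\<lambda>i. t * y i) = t\<^sup>2 * N y" and Qsmult: "Q (\<lambda>i. t * y i) = t\<^sup>2 * Q y" for t y
    by (simp_all add: N_def Q_def sum_distrib_left power_mult_distrib power2_eq_square mult_ac)
  have N0: "N y \<ge> 0" for y
    by (simp add: N_def sum_nonneg)
  have le: "Q y \<le> Q v * N y" for y
  proof (cases "N y = 0")
    case True
    then have "\<forall>i<n. y i = 0"
      by (simp add: N_def sum_nonneg_eq_0_iff)
    then show ?thesis
      using True by (simp add: Q_def)
  next
    case False
    define t where "t = 1 / sqrt (N y)"
    have t: "t\<^sup>2 * N y = 1"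
      using False N0[of y] by (simp add: t_def power_divide)
    then have "t\<^sup>2 * Q y \<le> Q v"
      using max[of "\<lambda>i. t * y i"] by (simp add: Nsmult Qsmult)
    then have "N y * (t\<^sup>2 * Q y) \<le> N y * Q v"
      using N0 by (rule mult_left_mono)
    then show ?thesis
      using t by (metis mult.assoc mult.commute mult_1)
  qed
  define g where "g = (\<lambda>i. Q v * v i - (\<Sum>j<n. a i j * v j))"
  define s where "s = N g"
  define b where "b = Q v * N g - Q g"
  \<comment> \<open>The nonnegative form \<open>Q v * N z - Q z\<close> vanishes at
    \<open>z = v\<close>. By symmetry of \<open>a\<close>, its first-order term along
    \<open>g\<close> is \<open>2 * t * N g\<close>.\<close>
  have quad: "0 \<le> 2 * t * s + t\<^sup>2 * b" for t
  proof -
    have N_add: "N (\<lambda>i. v i + t * g i) = 1 + 2 * t * (\<Sum>i<n. v i * g i) + t\<^sup>2 * N g"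
      unfolding v[symmetric]
      by (simp add: N_def power2_eq_square algebra_simps sum.distrib sum_distrib_left)
    have "(\<Sum>i<n. \<Sum>j<n. a i j * g j * v i) = (\<Sum>j<n. \<Sum>i<n. a i j * g j * v i)"
      by (rule sum.swap)
    also have "\<dots> = (\<Sum>i<n. \<Sum>j<n. a i j * g i * v j)"
      by (intro sum.cong refl) (simp add: sym)
    finally have swap: "(\<Sum>i<n. \<Sum>j<n. a i j * g j * v i) = (\<Sum>i<n. \<Sum>j<n. a i j * g i * v j)" .
    have "Q (\<lambda>i. v i + t * g i) =
        Q v + t * (\<Sum>i<n. \<Sum>j<n. a i j * g i * v j) + t * (\<Sum>i<n. \<Sum>j<n. a i j * g j * v i) + t\<^sup>2 * Q g"
      by (simp add: Q_def power2_eq_square algebra_simps sum.distrib sum_distrib_left)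
    then have Q_add: "Q (\<lambda>i. v i + t * g i) = Q v + 2 * t * (\<Sum>i<n. \<Sum>j<n. a i j * g i * v j) + t\<^sup>2 * Q g"
      using swap by simp
    define p r where "p = (\<Sum>i<n. v i * g i)" and "r = (\<Sum>i<n. \<Sum>j<n. a i j * g i * v j)"
    have "s = Q v * (\<Sum>i<n. v i * g i) - (\<Sum>i<n. \<Sum>j<n. a i j * g i * v j)"
    proof -
      have "s = (\<Sum>i<n. g i * (Q v * v i - (\<Sum>j<n. a i j * v j)))"
        by (simp add: s_def N_def power2_eq_square g_def)
      also have "\<dots> = Q v * (\<Sum>i<n. v i * g i) - (\<Sum>i<n. \<Sum>j<n. a i j * g i * v j)"
        by (simp add: right_diff_distrib sum_subtractf sum_distrib_left mult_ac)
      finally show ?thesis .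
    qed
    then have s: "s = Q v * p - r"
      by (simp only: p_def r_def)
    have "Q v * N (\<lambda>i. v i + t * g i) - Q (\<lambda>i. v i + t * g i) = 2 * t * s + t\<^sup>2 * b"
      unfolding N_add Q_add b_def p_def[symmetric] r_def[symmetric] s
      by (simp add: algebra_simps)
    then show ?thesis
      using le[of "\<lambda>i. v i + t * g i"] by linarith
  qed
  have "s = 0"
  proof (rule ccontr)
    assume "s \<noteq> 0"
    then have "s > 0"
      using N0[of g] by (simp add: s_def)
    have "b \<ge> 0"
      using le[of g] by (simp add: b_def)
    \<comment> \<open>The quadratic is minimal at \<open>t = - s / b\<close>; the denominator
      \<open>b + 1\<close> also covers \<open>b = 0\<close> and still gives a negative
      value.\<close>
    define e where "e = s / (b + 1)"
    have e: "e > 0" "s = e * (b + 1)"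
      using \<open>b \<ge> 0\<close> \<open>s > 0\<close> by (simp_all add: e_def)
    have "2 * (- e) * s + (- e)\<^sup>2 * b = - (e\<^sup>2 * (b + 2))"
      by (simp add: e(2) power2_eq_square algebra_simps)
    also have "\<dots> < 0"
      using e(1) \<open>b \<ge> 0\<close> by simp
    finally show False
      using quad[of "- e"] by linarith
  qed
  then have "\<forall>i<n. g i = 0"
    by (simp add: s_def N_def sum_nonneg_eq_0_iff)
  moreover have "\<exists>i<n. v i \<noteq> 0"
    using v by (force simp: N_def intro: ccontr)
  moreover have "\<mu> * N x \<le> Q v * N x"
    using le[of x] ge by (simp add: N_def Q_def)
  then have "\<mu> \<le> Q v"
    using pos by (simp add: N_def)
  ultimately show thesis
    using that[of "Q v" v] by (auto simp: g_def)
qed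

section \<open>From Rayleigh quotients to \<open>lambda1\<close> and
  \<open>lambda1_max\<close>\<close>

lemma lambda1_ge_rayleigh_quotient:
  assumes G: "pair_graph G" "pverts G = {0..<n}"
    and pos: "0 < (\<Sum>i<n. (x i)\<^sup>2)"
    and ge: "\<mu> * (\<Sum>i<n. (x i)\<^sup>2) \<le> (\<Sum>i<n. x i * (\<Sum>j | (i, j) \<in> parcs G. x j))"
  shows "\<mu> \<le> lambda1 G"
proof -
  interpret pair_graph G by fact
  define a :: "nat \<Rightarrow> nat \<Rightarrow> real" where "a = (\<lambda>i j. if (i, j) \<in> parcs G then 1 else 0)"
  have A: "adjacency_matrix G = mat n n (\<lambda>(i, j). a i j)"
    by (simp add: adjacency_matrix_def a_def G(2))
  have row: "(\<Sum>j | (i, j) \<in> parcs G. x j) = (\<Sum>j<n. a i j * x j)" for i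
  proof -
    have "(\<Sum>j<n. a i j * x j) = (\<Sum>j<n. if (i, j) \<in> parcs G then x j else 0)"
      by (intro sum.cong) (auto simp: a_def)
    also have "\<dots> = (\<Sum>j | j \<in> {..<n} \<and> (i, j) \<in> parcs G. x j)"
      by (simp add: sum.If_cases Int_def)
    also have "{j. j \<in> {..<n} \<and> (i, j) \<in> parcs G} = {j. (i, j) \<in> parcs G}"
      using in_arcsD2 G(2) by auto
    finally show ?thesis by simp
  qed
  have "\<mu> * (\<Sum>i<n. (x i)\<^sup>2) \<le> (\<Sum>i<n. \<Sum>j<n. a i j * x i * x j)"
    using ge by (simp add: row sum_distrib_left mult_ac)
  moreover have "a i j = a j i" for i j
    using arcs_symmetric by (auto simp: a_def)
  ultimately obtain l v where l: "\<mu> \<le> l" and v: "\<exists>i<n. v i \<noteq> 0"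
    and ev: "\<And>i. i < n \<Longrightarrow> (\<Sum>j<n. a i j * v j) = l * v i"
    using rayleigh_quotient_le_eigenvalue[of n a x \<mu>] pos by blast
  have "eigenvector (adjacency_matrix G) (vec n v) l"
    unfolding eigenvector_def A using v ev
    by (auto simp: vec_eq_iff scalar_prod_def atLeast0LessThan)
  then have "l \<in> spectrum (adjacency_matrix G)"
    by (auto simp: spectrum_def eigenvalue_def)
  moreover have "finite (spectrum (adjacency_matrix G))"
    by (rule card_finite_spectrum(1)[of _ n]) (simp add: A)
  ultimately show ?thesis
    unfolding lambda1_def using l by (meson Max_ge order_trans)
qed

lemma finite_connected_nonregular_graphs: "finite (connected_nonregular_graphs n \<Delta>)"
proof (rule finite_subset)
  show "connected_nonregular_graphs n \<Delta> \<subseteq>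
      (\<lambda>E. \<lparr>pverts = {0..<n}, parcs = E\<rparr>) ` Pow ({0..<n} \<times> {0..<n})"
  proof
    fix G assume "G \<in> connected_nonregular_graphs n \<Delta>"
    then have G: "pair_graph G" "pverts G = {0..<n}"
      by (auto simp: connected_nonregular_graphs_def)
    then interpret pair_graph G by blast
    have "parcs G \<subseteq> {0..<n} \<times> {0..<n}"
      using in_arcsD1 in_arcsD2 G(2) by auto
    moreover have "G = \<lparr>pverts = {0..<n}, parcs = parcs G\<rparr>"
      using G(2) by simp
    ultimately show "G \<in> (\<lambda>E. \<lparr>pverts = {0..<n}, parcs = E\<rparr>) ` Pow ({0..<n} \<times> {0..<n})"
      by blast
  qed
qed simp

text \<open>Relabelling along a bijection with \<open>{0..<n}\<close> allows the extremal graph to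
  be built on any convenient vertex type, given by neighbourhoods.\<close>

lemma lambda1_max_ge:
  fixes V :: "'a set" and N :: "'a \<Rightarrow> 'a set" and x :: "'a \<Rightarrow> real"
  assumes V: "finite V" "card V = n" "r \<in> V"
    and N: "\<And>v. v \<in> V \<Longrightarrow> N v \<subseteq> V" "\<And>v. v \<in> V \<Longrightarrow> v \<notin> N v"
    and sym: "\<And>u v. u \<in> V \<Longrightarrow> v \<in> N u \<Longrightarrow> u \<in> N v"
    and conn: "\<And>v. v \<in> V \<Longrightarrow> (r, v) \<in> {(u, v). u \<in> V \<and> v \<in> N u}\<^sup>*"
    and deg: "\<And>v. v \<in> V \<Longrightarrow> card (N v) \<le> \<Delta>" "\<exists>v\<in>V. card (N v) = \<Delta>" "\<exists>v\<in>V. card (N v) < \<Delta>"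
    and pos: "0 < (\<Sum>v\<in>V. (x v)\<^sup>2)"
    and ge: "\<mu> * (\<Sum>v\<in>V. (x v)\<^sup>2) \<le> (\<Sum>v\<in>V. x v * (\<Sum>u\<in>N v. x u))"
  shows "\<mu> \<le> lambda1_max n \<Delta>"
proof -
  obtain f where f: "bij_betw f {0..<n} V"
    using V ex_bij_betw_nat_finite by blast
  have inj: "inj_on f {0..<n}" and im: "f ` {0..<n} = V"
    using f by (auto simp: bij_betw_def)
  have fV: "f i \<in> V" if "i < n" for i
    using that im by auto
  define G where "G = \<lparr>pverts = {0..<n}, parcs = {(i, j). i < n \<and> j < n \<and> f j \<in> N (f i)}\<rparr>"
  have Gv: "pverts G = {0..<n}" and Ga: "(i, j) \<in> parcs G \<longleftrightarrow> i < n \<and> j < n \<and> f j \<in> N (f i)" for i j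
    by (auto simp: G_def)
  have symG: "symmetric (with_proj G)"
    using sym fV by (auto simp: symmetric_def sym_def Ga)
  have G: "pair_graph G"
  proof
    show "finite (parcs G)"
      by (rule finite_subset[of _ "{0..<n} \<times> {0..<n}"]) (auto simp: Ga)
  qed (use N(2) fV symG in \<open>auto simp: Gv Ga\<close>)
  then interpret pair_graph G .
  have nbr: "bij_betw f {j. (i, j) \<in> parcs G} (N (f i))" if "i < n" for i
    unfolding bij_betw_def
  proof
    show "inj_on f {j. (i, j) \<in> parcs G}"
      by (rule inj_on_subset[OF inj]) (auto simp: Ga)
    show "f ` {j. (i, j) \<in> parcs G} = N (f i)"
      using N(1)[OF fV[OF that]] that im by (fastforce simp: Ga image_iff)
  qed
  have out_deg: "out_degree (with_proj G) i = card (N (f i))" if "i < n" for i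
  proof -
    have "out_arcs (with_proj G) i = Pair i ` {j. (i, j) \<in> parcs G}"
      by (auto simp: out_arcs_def)
    then have "out_degree (with_proj G) i = card {j. (i, j) \<in> parcs G}"
      by (simp add: out_degree_def card_image inj_on_def)
    then show ?thesis
      using bij_betw_same_card[OF nbr[OF that]] by simp
  qed
  have "max_degree G = \<Delta>"
    unfolding max_degree_def
  proof (rule Max_eqI)
    show "\<Delta> \<in> out_degree (with_proj G) ` pverts G"
      using deg(2) im out_deg by (fastforce simp: Gv image_iff)
  qed (use deg(1) out_deg fV in \<open>auto simp: Gv\<close>)
  moreover have "\<not> regular_graph G"
  proof
    assume reg: "regular_graph G"
    obtain i j where ij: "i < n" "j < n" "card (N (f i)) = \<Delta>" "card (N (f j)) < \<Delta>"
      using deg(2,3) unfolding im[symmetric] by auto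
    then have "out_degree (with_proj G) i = out_degree (with_proj G) j"
      using reg unfolding regular_graph_def Gv by (metis atLeastLessThan_iff le0)
    then show False
      using ij by (simp add: out_deg)
  qed
  moreover have "Digraph_Component.connected (with_proj G)"
  proof -
    obtain k where k: "k < n" "f k = r"
      using V(3) im by auto
    have reach: "\<forall>i<n. f i = v \<longrightarrow> reachable (with_proj G) k i" if "(r, v) \<in> {(u, v). u \<in> V \<and> v \<in> N u}\<^sup>*" for v
      using that
    proof (induction rule: rtrancl_induct)
      case base
      then show ?case
        using k inj Gv by (metis atLeastLessThan_iff inj_onD le0 reachable_refl)
    next
      case (step u v)
      then obtain i where i: "i < n" "f i = u"
        using im by auto
      show ?case
      proof (intro allI impI)
        fix j assume j: "j < n" "f j = v"
        have "reachable (with_proj G) k i"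
          using step.IH i by blast
        moreover have "(i, j) \<in> parcs G"
          using i j step.hyps by (simp add: Ga)
        ultimately show "reachable (with_proj G) k j"
          by (rule reachable_adj_trans)
      qed
    qed
    have from_k: "reachable (with_proj G) k i" if "i < n" for i
      using reach conn fV that by blast
    have "reachable (with_proj G) i j" if "i < n" "j < n" for i j
      using symmetric_reachable[OF symG from_k[OF that(1)]] from_k[OF that(2)]
      by (rule reachable_trans)
    then have "strongly_connected (with_proj G)"
      using k(1) by (auto simp: strongly_connected_def Gv)
    \<comment> \<open>Connectedness refers to the symmetric closure of the arcs, which here adds
      nothing.\<close>
    moreover have "symcl (parcs G) = parcs G"
      using arcs_symmetric by (auto simp: symcl_def)
    ultimately show ?thesis
      by (simp add: connected_conv strongly_connected_def reachable_def)
  qed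
  ultimately have mem: "G \<in> connected_nonregular_graphs n \<Delta>"
    using G Gv by (simp add: connected_nonregular_graphs_def)
  have reindex: "(\<Sum>i<n. h (f i)) = sum h V" for h :: "'a \<Rightarrow> real"
    using sum.reindex_bij_betw[OF f, of h] by (simp add: atLeast0LessThan)
  have "(\<Sum>i<n. x (f i) * (\<Sum>j | (i, j) \<in> parcs G. x (f j))) = (\<Sum>i<n. x (f i) * (\<Sum>u\<in>N (f i). x u))"
    by (intro sum.cong refl) (simp add: sum.reindex_bij_betw[OF nbr, of _ x])
  then have "\<mu> \<le> lambda1 G"
    using pos ge
    by (intro lambda1_ge_rayleigh_quotient[OF G Gv, of "\<lambda>i. x (f i)"])
       (simp_all add: reindex[of "\<lambda>v. (x v)\<^sup>2"] reindex[of "\<lambda>v. x v * (\<Sum>u\<in>N v. x u)"])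
  also have "\<dots> \<le> lambda1_max n \<Delta>"
    unfolding lambda1_max_def
    using mem by (intro Max_ge finite_imageI finite_connected_nonregular_graphs imageI)
  finally show ?thesis .
qed

subsection \<open>The chain of blocks\<close>

datatype vertex = Cap nat | Blk nat nat | Tail nat

text \<open>\<open>C\<close> gives the neighbourhoods inside the cap, whose vertices \<open>p < c\<close> are the ports: each of them
  has one further edge, to entry \<open>p\<close> of block \<open>0\<close>. In every block the entries are the vertices
  \<open>p < c\<close> and the exit is the vertex \<open>\<Delta>\<close>.\<close>

locale capped_chain =
  fixes \<Delta> c K :: nat and C :: "nat \<Rightarrow> nat set" and m q :: nat
  assumes c: "0 < c" "c < \<Delta>" and K: "\<Delta> < K" and m: "0 < m" and q: "0 < q"
    and \<Delta>: "2 < \<Delta>"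
    and cap_closed: "\<And>i. i < K \<Longrightarrow> C i \<subseteq> {..<K}"
    and cap_irrefl: "\<And>i. i < K \<Longrightarrow> i \<notin> C i"
    and cap_sym: "\<And>i j. i < K \<Longrightarrow> j \<in> C i \<Longrightarrow> i \<in> C j"
    and cap_degree: "\<And>i. i < K \<Longrightarrow> card (C i) + (if i < c then 1 else 0) = \<Delta>"
    and cap_connected: "\<And>i. i < K \<Longrightarrow> (0, i) \<in> {(i, j). i < K \<and> j \<in> C i}\<^sup>*"
begin

definition V :: "vertex set" where
  "V = Cap ` {..<K} \<union> (\<lambda>(j, p). Blk j p) ` ({..<m} \<times> {..\<Delta>}) \<union> Tail ` {..<q}"

primrec nbrs :: "vertex \<Rightarrow> vertex set" where
  "nbrs (Cap i) = Cap ` C i \<union> (if i < c then {Blk 0 i} else {})"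
| "nbrs (Blk j p) =
    (if p < c then Blk j ` ({..<\<Delta>} - {p}) \<union> {if j = 0 then Cap p else Blk (j - 1) \<Delta>}
     else if p < \<Delta> then Blk j ` ({..\<Delta>} - {p})
     else Blk j ` {c..<\<Delta>} \<union> (if Suc j < m then Blk (Suc j) ` {..<c} else {Tail 0}))"
| "nbrs (Tail i) =
    {if i = 0 then Blk (m - 1) \<Delta> else Tail (i - 1)} \<union> (if Suc i < q then {Tail (Suc i)} else {})"

lemma in_V [simp]:
  "Cap i \<in> V \<longleftrightarrow> i < K" "Blk j p \<in> V \<longleftrightarrow> j < m \<and> p \<le> \<Delta>" "Tail i \<in> V \<longleftrightarrow> i < q"
  by (auto simp: V_def)

lemma finite_V: "finite V"
  by (simp add: V_def)

lemma sum_V: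
  fixes h :: "vertex \<Rightarrow> 'b::comm_monoid_add"
  shows "sum h V = (\<Sum>i<K. h (Cap i)) + (\<Sum>j<m. \<Sum>p\<le>\<Delta>. h (Blk j p)) + (\<Sum>i<q. h (Tail i))"
proof -
  have "sum h V = sum h (Cap ` {..<K}) + sum h ((\<lambda>(j, p). Blk j p) ` ({..<m} \<times> {..\<Delta>})) + sum h (Tail ` {..<q})"
    unfolding V_def by (subst sum.union_disjoint, auto)+
  also have "sum h ((\<lambda>(j, p). Blk j p) ` ({..<m} \<times> {..\<Delta>})) = (\<Sum>j<m. \<Sum>p\<le>\<Delta>. h (Blk j p))"
    by (subst sum.reindex) (auto simp: inj_on_def sum.cartesian_product case_prod_unfold)
  finally show ?thesis
    by (simp add: sum.reindex inj_on_def)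
qed

lemma card_V: "card V = K + m * (\<Delta> + 1) + q"
  using sum_V[of "\<lambda>_. 1::nat"] by simp

lemma sum_block:
  fixes h :: "nat \<Rightarrow> 'b::comm_monoid_add"
  shows "(\<Sum>p\<le>\<Delta>. h p) = (\<Sum>p<c. h p) + (\<Sum>p=c..<\<Delta>. h p) + h \<Delta>"
proof -
  have "{..\<Delta>} = insert \<Delta> ({..<c} \<union> {c..<\<Delta>})"
    using c by auto
  then have "(\<Sum>p\<le>\<Delta>. h p) = sum h (insert \<Delta> ({..<c} \<union> {c..<\<Delta>}))"
    by (rule arg_cong)
  also have "\<dots> = h \<Delta> + sum h ({..<c} \<union> {c..<\<Delta>})"
    using c by (intro sum.insert) auto
  also have "sum h ({..<c} \<union> {c..<\<Delta>}) = (\<Sum>p<c. h p) + (\<Sum>p=c..<\<Delta>. h p)"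
    by (intro sum.union_disjoint) auto
  finally show ?thesis
    by (simp add: add_ac)
qed

lemma nbrs_subset_V: "v \<in> V \<Longrightarrow> nbrs v \<subseteq> V"
  using cap_closed c m q K by (cases v) (auto split: if_splits dest: subsetD[OF cap_closed])

lemma nbrs_irrefl: "v \<in> V \<Longrightarrow> v \<notin> nbrs v"
  using cap_irrefl c by (cases v) (auto split: if_splits)

lemma nbrs_sym: "u \<in> V \<Longrightarrow> v \<in> nbrs u \<Longrightarrow> u \<in> nbrs v"
  using cap_sym c m q K by (cases u; cases v) (auto split: if_splits)

section \<open>Sums over neighbourhoods, used with the constant 1 for degrees and with the test
  vector for its energy\<close>

lemma sum_nbrs_Cap:
  fixes h :: "vertex \<Rightarrow> 'b::comm_monoid_add"
  assumes "i < K"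
  shows "sum h (nbrs (Cap i)) = (\<Sum>j\<in>C i. h (Cap j)) + (if i < c then h (Blk 0 i) else 0)"
proof -
  have "finite (C i)"
    using cap_closed[OF assms] finite_subset by blast
  then show ?thesis
    by (auto simp: sum.reindex inj_on_def sum.union_disjoint image_iff add_ac)
qed

lemma sum_nbrs_Blk_entry:
  fixes h :: "vertex \<Rightarrow> 'b::ab_group_add"
  assumes "p < c"
  shows "sum h (nbrs (Blk j p)) =
    (\<Sum>s<c. h (Blk j s)) + (\<Sum>s=c..<\<Delta>. h (Blk j s)) - h (Blk j p)
      + h (if j = 0 then Cap p else Blk (j - 1) \<Delta>)"
proof -
  have "sum h (nbrs (Blk j p)) = sum h (Blk j ` ({..<\<Delta>} - {p})) + h (if j = 0 then Cap p else Blk (j - 1) \<Delta>)"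
    using assms by (auto simp: image_iff add_ac)
  also have "sum h (Blk j ` ({..<\<Delta>} - {p})) = (\<Sum>s<\<Delta>. h (Blk j s)) - h (Blk j p)"
    using assms c by (subst sum.reindex) (auto simp: inj_on_def sum_diff1)
  also have "{..<\<Delta>} = {..<c} \<union> {c..<\<Delta>}"
    using c by auto
  finally show ?thesis
    by (simp add: sum.union_disjoint ivl_disj_int)
qed

lemma sum_nbrs_Blk_middle:
  fixes h :: "vertex \<Rightarrow> 'b::ab_group_add"
  assumes "c \<le> p" "p < \<Delta>"
  shows "sum h (nbrs (Blk j p)) =
    (\<Sum>s<c. h (Blk j s)) + (\<Sum>s=c..<\<Delta>. h (Blk j s)) + h (Blk j \<Delta>) - h (Blk j p)"
proof -
  have "sum h (nbrs (Blk j p)) = (\<Sum>s\<le>\<Delta>. h (Blk j s)) - h (Blk j p)"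
    using assms by (simp add: sum.reindex inj_on_def sum_diff1)
  then show ?thesis
    by (simp add: sum_block)
qed

lemma sum_nbrs_Blk_exit:
  fixes h :: "vertex \<Rightarrow> 'b::comm_monoid_add"
  shows "sum h (nbrs (Blk j \<Delta>)) =
    (\<Sum>s=c..<\<Delta>. h (Blk j s)) + (if Suc j < m then (\<Sum>s<c. h (Blk (Suc j) s)) else h (Tail 0))"
proof -
  have "sum h (nbrs (Blk j \<Delta>)) =
      sum h (Blk j ` {c..<\<Delta>}) + sum h (if Suc j < m then Blk (Suc j) ` {..<c} else {Tail 0})"
    using c by (auto simp: image_iff add.commute intro!: sum.union_disjoint)
  then show ?thesis
    by (simp add: sum.reindex inj_on_def)
qed

lemma degree_Blk: "p < \<Delta> \<Longrightarrow> card (nbrs (Blk j p)) = \<Delta>"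
  using c sum_nbrs_Blk_entry[of p "\<lambda>_. 1::int" j] sum_nbrs_Blk_middle[of p "\<lambda>_. 1::int" j]
  by (cases "p < c") (simp_all del: nbrs.simps add: of_nat_diff)

lemma degree_Tail: "card (nbrs (Tail i)) \<le> 2"
  by (auto simp: card_insert_if)

text \<open>The last exit has a single tail neighbour in place of \<open>c\<close> entries, hence
  degree \<open>\<Delta> - c + 1\<close>.\<close>

lemma degree_le:
  assumes "v \<in> V"
  shows "card (nbrs v) \<le> \<Delta>"
proof (cases v)
  case (Cap i)
  then show ?thesis
    using assms sum_nbrs_Cap[of i "\<lambda>_. 1::nat"] cap_degree[of i] by (simp del: nbrs.simps)
next
  case (Blk j p)
  show ?thesis
  proof (cases "p < \<Delta>")
    case False
    then show ?thesis
      using assms Blk c sum_nbrs_Blk_exit[of "\<lambda>_. 1::nat" j]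
      by (auto simp del: nbrs.simps split: if_splits)
  qed (use Blk degree_Blk in simp)
next
  case (Tail i)
  then show ?thesis
    using degree_Tail[of i] \<Delta> by simp
qed

section \<open>Connectedness of the chain\<close>

lemma connected_from_cap:
  assumes "v \<in> V"
  shows "(Cap 0, v) \<in> {(u, v). u \<in> V \<and> v \<in> nbrs u}\<^sup>*" (is "_ \<in> ?R\<^sup>*")
proof -
  have step: "(Cap 0, v) \<in> ?R\<^sup>*" if "(Cap 0, u) \<in> ?R\<^sup>*" "u \<in> V" "v \<in> nbrs u" for u v
    using that by (auto intro: rtrancl_into_rtrancl)
  have cap: "(Cap 0, Cap i) \<in> ?R\<^sup>*" if "i < K" for i
    using cap_connected[OF that]
    by (induction rule: rtrancl_induct) (auto intro: step)
  have block: "(Cap 0, Blk j p) \<in> ?R\<^sup>*" if "(Cap 0, Blk j 0) \<in> ?R\<^sup>*" "j < m" "p \<le> \<Delta>" for j p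
  proof -
    \<comment> \<open>Entry 0 is not adjacent to the exit, but vertex \<open>c\<close> is neither
      entry nor exit and is adjacent to its whole block.\<close>
    have *: "(Cap 0, Blk j c) \<in> ?R\<^sup>*"
      by (rule step[OF that(1)]) (use that c in auto)
    show ?thesis
    proof (cases "p = c")
      case False
      then show ?thesis
        by (intro step[OF *]) (use that c in auto)
    qed (use * in simp)
  qed
  have entry: "(Cap 0, Blk j 0) \<in> ?R\<^sup>*" if "j < m" for j
    using that
  proof (induction j)
    case 0
    then show ?case
      by (intro step[OF rtrancl.rtrancl_refl]) (use c K in auto)
  next
    case (Suc j)
    then have "(Cap 0, Blk j \<Delta>) \<in> ?R\<^sup>*"
      using block[of j \<Delta>] by auto
    then show ?case
      by (rule step) (use c Suc.prems in auto)
  qed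
  have tail: "(Cap 0, Tail i) \<in> ?R\<^sup>*" if "i < q" for i
    using that
  proof (induction i)
    case 0
    have "(Cap 0, Blk (m - 1) \<Delta>) \<in> ?R\<^sup>*"
      using m by (auto intro: block[OF entry])
    then show ?case
      by (rule step) (use m c in auto)
  next
    case (Suc i)
    then have "(Cap 0, Tail i) \<in> ?R\<^sup>*"
      by simp
    then show ?case
      by (rule step) (use Suc.prems in auto)
  qed
  show ?thesis
    using assms cap block entry tail by (cases v) auto
qed

section \<open>The test vector\<close>

definition \<theta> :: real where "\<theta> = pi / (2 * real m)"

text \<open>A quarter period of the cosine over \<open>m\<close> blocks: slope 0 at the cap (Neumann
  end), value 0 at the tail (Dirichlet end).\<close>

definition y :: "nat \<Rightarrow> real" where "y j = cos (\<theta> * real j)"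

text \<open>The current through an edge from an entry to a middle vertex. By Kirchhoff's law the
  potential drops from entry to middle to exit to next entry are \<open>1\<close>, \<open>c\<close>
  and \<open>\<Delta> - c\<close> times \<open>d j\<close>, in total \<open>\<Delta> + 1\<close>
  times.\<close>

definition d :: "nat \<Rightarrow> real" where "d j = (y j - y (Suc j)) / (real \<Delta> + 1)"

text \<open>Viewing every edge as a unit resistor, this is the potential that takes the value \<open>y j\<close> on
  the entries of block \<open>j\<close> and is harmonic on all other vertices of the blocks.\<close>

primrec x :: "vertex \<Rightarrow> real" where
  "x (Cap i) = 1"
| "x (Blk j p) = y j - (if p < c then 0 else if p < \<Delta> then d j else (real c + 1) * d j)"
| "x (Tail i) = 0"

lemma y_Suc: "y (Suc j) = y j - (real \<Delta> + 1) * d j"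
  by (simp add: d_def)

lemma y_0: "y 0 = 1"
  by (simp add: y_def)

lemma y_m: "y m = 0"
  using m by (simp add: y_def \<theta>_def)

lemma angle: "j \<le> m \<Longrightarrow> 0 \<le> \<theta> * real j \<and> \<theta> * real j \<le> pi / 2"
  using m by (simp add: \<theta>_def field_simps)

lemma y_nonneg: "j \<le> m \<Longrightarrow> 0 \<le> y j"
  using angle[of j] by (auto simp: y_def intro!: cos_ge_zero)

lemma d_nonneg:
  assumes "j < m"
  shows "0 \<le> d j"
proof -
  have "y (Suc j) \<le> y j"
    unfolding y_def
  proof (rule cos_monotone_0_pi_le)
    show "\<theta> * real (Suc j) \<le> pi"
      using angle[of "Suc j"] assms pi_gt_zero by linarith
    show "0 \<le> \<theta> * real j"
      using angle[of j] assms by simp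
    show "\<theta> * real j \<le> \<theta> * real (Suc j)"
      by (intro mult_left_mono) (auto simp: \<theta>_def)
  qed
  then show ?thesis
    by (simp add: d_def)
qed

lemma x_ge_y_Suc:
  assumes "j < m"
  shows "y (Suc j) \<le> x (Blk j p)"
proof -
  have "(real c + 1) * d j \<le> (real \<Delta> + 1) * d j"
    using c d_nonneg[OF assms] by (intro mult_right_mono) auto
  moreover have "1 * d j \<le> (real \<Delta> + 1) * d j"
    using d_nonneg[OF assms] by (intro mult_right_mono) auto
  moreover have "0 \<le> (real \<Delta> + 1) * d j"
    using d_nonneg[OF assms] by simp
  ultimately show ?thesis
    by (auto simp: y_Suc)
qed

section \<open>Energy and norm of the test vector\<close>

text \<open>This is \<open>\<Delta>\<close> times the identity minus the adjacency matrix, applied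
  to \<open>x\<close>. It is the Laplacian at vertices of degree \<open>\<Delta>\<close>; a missing
  degree acts like an edge to a vertex of value 0.\<close>

definition L :: "vertex \<Rightarrow> real" where
  "L v = real \<Delta> * x v - (\<Sum>u\<in>nbrs v. x u)"

text \<open>Each cap vertex has degree \<open>\<Delta>\<close>, and \<open>x\<close> is 1 on it and
  all its neighbours, since \<open>y 0 = 1\<close>.\<close>

lemma L_Cap:
  assumes "i < K"
  shows "L (Cap i) = 0"
proof -
  have "(\<Sum>u\<in>nbrs (Cap i). x u) = real (card (C i)) + (if i < c then 1 else 0)"
    using sum_nbrs_Cap[OF assms, of x] c by (simp add: y_0 del: nbrs.simps)
  also have "\<dots> = real \<Delta>"
    using cap_degree[OF assms] by (auto split: if_splits)
  finally show ?thesis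
    by (simp add: L_def)
qed

lemma L_Blk_nonentry:
  assumes "j < m" "c \<le> p" "p \<le> \<Delta>"
  shows "L (Blk j p) = 0"
proof (cases "p < \<Delta>")
  case True
  then show ?thesis
    using assms c sum_nbrs_Blk_middle[of p x j]
    by (simp add: L_def of_nat_diff algebra_simps del: nbrs.simps)
next
  case False
  then have "p = \<Delta>"
    using assms by simp
  \<comment> \<open>After the last block, \<open>c\<close> fictitious entries of value
    \<open>y m = 0\<close> contribute the same as the tail vertex.\<close>
  moreover have "(if Suc j < m then (\<Sum>s<c. x (Blk (Suc j) s)) else x (Tail 0)) = real c * y (Suc j)"
  proof (cases "Suc j < m")
    case False
    then have "Suc j = m"
      using assms by simp
    then show ?thesis
      using y_m by simp
  qed simp
  ultimately show ?thesis
    using c sum_nbrs_Blk_exit[of x j]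
    by (simp add: L_def y_Suc of_nat_diff algebra_simps del: nbrs.simps)
qed

text \<open>Net current out of an entry: \<open>(\<Delta> - c) * d j\<close> leaves to the middle
  vertices, \<open>(\<Delta> - c) * d (j - 1)\<close> arrives from the previous exit, and nothing
  arrives from the cap if \<open>j = 0\<close>.\<close>

lemma L_Blk_entry:
  assumes "p < c"
  shows "L (Blk j p) = (real \<Delta> - real c) * (d j - (if j = 0 then 0 else d (j - 1)))"
proof (cases j)
  case 0
  then show ?thesis
    using assms c sum_nbrs_Blk_entry[of p x j]
    by (simp add: L_def y_0 of_nat_diff algebra_simps del: nbrs.simps)
next
  case (Suc i)
  then show ?thesis
    using assms c sum_nbrs_Blk_entry[of p x j]
    by (simp add: L_def y_Suc of_nat_diff algebra_simps del: nbrs.simps)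
qed

text \<open>For \<open>j > 0\<close> equality holds, because the cosine is an eigenfunction of the
  second difference. For \<open>j = 0\<close> the one-sided difference
  \<open>1 - cos \<theta>\<close> is only half the bound.\<close>

lemma L_Blk_entry_le:
  assumes "p < c" "j < m"
  shows "L (Blk j p) \<le> (real \<Delta> - real c) / (real \<Delta> + 1) * (2 * (1 - cos \<theta>)) * y j"
proof -
  have "(real \<Delta> + 1) * (d j - (if j = 0 then 0 else d (j - 1))) \<le> 2 * (1 - cos \<theta>) * y j"
  proof (cases j)
    case 0
    then show ?thesis
      by (simp add: d_def y_def)
  next
    case (Suc i)
    have "y (Suc (Suc i)) = cos (\<theta> * real (Suc i) + \<theta>)" "y i = cos (\<theta> * real (Suc i) - \<theta>)"
      by (simp_all add: y_def algebra_simps)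
    then have "y (Suc (Suc i)) + y i = 2 * cos \<theta> * y (Suc i)"
      by (simp add: cos_add cos_diff y_def)
    moreover have "(real \<Delta> + 1) * d k = y k - y (Suc k)" for k
      by (simp add: d_def)
    ultimately show ?thesis
      using Suc by (simp add: right_diff_distrib left_diff_distrib)
  qed
  then have "(real \<Delta> - real c) / (real \<Delta> + 1) * ((real \<Delta> + 1) * (d j - (if j = 0 then 0 else d (j - 1))))
      \<le> (real \<Delta> - real c) / (real \<Delta> + 1) * (2 * (1 - cos \<theta>) * y j)"
    using c by (intro mult_left_mono) auto
  then show ?thesis
    by (simp add: L_Blk_entry[OF assms(1)] mult.assoc)
qed

text \<open>The constant of the energy bound divided by the factor \<open>\<Delta> + 1\<close> of
  the norm bound, both proved next.\<close>

definition \<epsilon> :: real where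
  "\<epsilon> = 2 * (1 - cos \<theta>) * real c * (real \<Delta> - real c) / (real \<Delta> + 1)\<^sup>2"

text \<open>Only entries contribute: \<open>L\<close> vanishes on the cap and the other block
  vertices, \<open>x\<close> vanishes on the tail.\<close>

lemma energy_le:
  "(\<Sum>v\<in>V. x v * L v) \<le>
    real c * ((real \<Delta> - real c) / (real \<Delta> + 1) * (2 * (1 - cos \<theta>))) * (\<Sum>j<m. (y j)\<^sup>2)"
proof -
  define k where "k = (real \<Delta> - real c) / (real \<Delta> + 1) * (2 * (1 - cos \<theta>))"
  have "(\<Sum>p\<le>\<Delta>. x (Blk j p) * L (Blk j p)) \<le> real c * k * (y j)\<^sup>2" if "j < m" for j
  proof -
    have "(\<Sum>p\<le>\<Delta>. x (Blk j p) * L (Blk j p)) = (\<Sum>p<c. y j * L (Blk j p))"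
      using c that by (simp add: sum_block L_Blk_nonentry)
    also have "\<dots> \<le> (\<Sum>p<c. y j * (k * y j))"
      using L_Blk_entry_le[OF _ that] y_nonneg[of j] that
      by (intro sum_mono mult_left_mono) (auto simp: k_def)
    also have "\<dots> = real c * k * (y j)\<^sup>2"
      by (simp add: power2_eq_square)
    finally show ?thesis .
  qed
  then show ?thesis
    unfolding k_def[symmetric]
    by (simp add: sum_V L_Cap sum_distrib_left del: x.simps(2)) (auto intro!: sum_mono simp del: x.simps(2))
qed

text \<open>Bounding block \<open>j\<close> below by \<open>y (Suc j)\<close> shifts the sum and
  loses the term \<open>y 0 = 1\<close>. The cap makes up for it, having at least
  \<open>\<Delta> + 1\<close> vertices of value 1.\<close>

lemma norm_ge: "(real \<Delta> + 1) * (\<Sum>j<m. (y j)\<^sup>2) \<le> (\<Sum>v\<in>V. (x v)\<^sup>2)"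
proof -
  have "(\<Sum>j<m. (y (Suc j))\<^sup>2) - (\<Sum>j<m. (y j)\<^sup>2) = (y m)\<^sup>2 - (y 0)\<^sup>2"
    using sum_lessThan_telescope[of "\<lambda>j. (y j)\<^sup>2" m] by (simp add: sum_subtractf)
  then have "(\<Sum>j<m. (y j)\<^sup>2) = 1 + (\<Sum>j<m. (y (Suc j))\<^sup>2)"
    by (simp add: y_0 y_m)
  then have "(real \<Delta> + 1) * (\<Sum>j<m. (y j)\<^sup>2) = (real \<Delta> + 1) + (\<Sum>j<m. \<Sum>p\<le>\<Delta>. (y (Suc j))\<^sup>2)"
    by (simp add: algebra_simps sum_distrib_left)
  also have "\<dots> \<le> real K + (\<Sum>j<m. \<Sum>p\<le>\<Delta>. (x (Blk j p))\<^sup>2)"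
  proof (rule add_mono)
    show "real \<Delta> + 1 \<le> real K"
      using K by simp
    show "(\<Sum>j<m. \<Sum>p\<le>\<Delta>. (y (Suc j))\<^sup>2) \<le> (\<Sum>j<m. \<Sum>p\<le>\<Delta>. (x (Blk j p))\<^sup>2)"
      using x_ge_y_Suc y_nonneg by (intro sum_mono power_mono) (auto simp del: x.simps)
  qed
  also have "\<dots> = (\<Sum>v\<in>V. (x v)\<^sup>2)"
    by (simp add: sum_V)
  finally show ?thesis .
qed

lemma lambda1_max_ge_chain: "real \<Delta> - \<epsilon> \<le> lambda1_max (K + m * (\<Delta> + 1) + q) \<Delta>"
proof (rule lambda1_max_ge[OF finite_V card_V _ nbrs_subset_V nbrs_irrefl nbrs_sym
      connected_from_cap degree_le])
  show "Cap 0 \<in> V"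
    using K by simp
  show "\<exists>v\<in>V. card (nbrs v) = \<Delta>"
    using degree_Blk[of 0 0] c m by (intro bexI[of _ "Blk 0 0"]) (auto simp del: nbrs.simps)
  show "\<exists>v\<in>V. card (nbrs v) < \<Delta>"
    using degree_Tail[of 0] \<Delta> q by (intro bexI[of _ "Tail 0"]) (auto simp del: nbrs.simps)
  have "0 < (\<Sum>j<m. (y j)\<^sup>2)"
    using m by (intro sum_pos2[of _ 0]) (auto simp: y_0)
  then show "0 < (\<Sum>v\<in>V. (x v)\<^sup>2)"
    by (intro less_le_trans[OF mult_pos_pos norm_ge]) auto
  have "(\<Sum>v\<in>V. x v * L v) \<le>
      \<epsilon> * ((real \<Delta> + 1) * (\<Sum>j<m. (y j)\<^sup>2))"
    using energy_le by (simp add: \<epsilon>_def power2_eq_square mult_ac)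
  also have "\<dots> \<le> \<epsilon> * (\<Sum>v\<in>V. (x v)\<^sup>2)"
    using c by (intro mult_left_mono norm_ge) (simp add: \<epsilon>_def)
  finally have "(\<Sum>v\<in>V. x v * L v) \<le> \<epsilon> * (\<Sum>v\<in>V. (x v)\<^sup>2)" .
  moreover have "(\<Sum>v\<in>V. x v * L v) = real \<Delta> * (\<Sum>v\<in>V. (x v)\<^sup>2) - (\<Sum>v\<in>V. x v * (\<Sum>u\<in>nbrs v. x u))"
    by (simp add: L_def right_diff_distrib sum_subtractf sum_distrib_left power2_eq_square mult_ac)
  ultimately show "(real \<Delta> - \<epsilon>) * (\<Sum>v\<in>V. (x v)\<^sup>2) \<le> (\<Sum>v\<in>V. x v * (\<Sum>u\<in>nbrs v. x u))"
    by (simp add: left_diff_distrib)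
qed

text \<open>Uses \<open>1 - cos \<theta> \<le> \<theta>\<^sup>2 / 2\<close>. The denominator is the
  number of block vertices, to be compared with \<open>n\<close>.\<close>

lemma \<epsilon>_le: "\<epsilon> \<le> pi\<^sup>2 / 4 * (real c * (real \<Delta> - real c)) / (real (m * (\<Delta> + 1)))\<^sup>2"
proof -
  have "1 - cos \<theta> = 2 * (sin (\<theta> / 2))\<^sup>2"
    using cos_double_sin[of "\<theta> / 2"] by simp
  also have "\<dots> \<le> 2 * (\<theta> / 2)\<^sup>2"
    using abs_sin_x_le_abs_x[of "\<theta> / 2"] by (intro mult_left_mono) (auto simp only: abs_le_square_iff)
  finally have "2 * (1 - cos \<theta>) \<le> \<theta>\<^sup>2"
    by (simp add: power2_eq_square)
  then have "2 * (1 - cos \<theta>) * (real c * (real \<Delta> - real c) / (real \<Delta> + 1)\<^sup>2)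
      \<le> \<theta>\<^sup>2 * (real c * (real \<Delta> - real c) / (real \<Delta> + 1)\<^sup>2)"
    using c by (intro mult_right_mono) auto
  also have "\<dots> = pi\<^sup>2 / 4 * (real c * (real \<Delta> - real c)) / (real m * (real \<Delta> + 1))\<^sup>2"
    by (simp add: \<theta>_def power_divide power_mult_distrib)
  also have "real m * (real \<Delta> + 1) = real (m * (\<Delta> + 1))"
    by (simp add: distrib_left)
  finally show ?thesis
    by (simp add: \<epsilon>_def mult.assoc)
qed

end

subsection \<open>Caps and the limit\<close>

lemma limsup_gap_le:
  assumes chain: "\<And>m q. 0 < m \<Longrightarrow> 0 < q \<Longrightarrow> capped_chain \<Delta> c K C m q" and D: "D > 0"
  shows "limsup (\<lambda>n. ereal ((real n)\<^sup>2 * (real \<Delta> - lambda1_max n \<Delta>) / D))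
    \<le> ereal (pi\<^sup>2 / 4 * (real c * (real \<Delta> - real c)) / D)"
proof -
  define w where "w = pi\<^sup>2 / 4 * (real c * (real \<Delta> - real c))"
  \<comment> \<open>A bound on the number of vertices outside the blocks: \<open>K\<close> in the
    cap and at most \<open>\<Delta> + 1\<close> in the tail.\<close>
  define a where "a = K + \<Delta> + 1"
  have "c < \<Delta>"
    using capped_chain.c(2)[OF chain[of 1 1]] by simp
  then have w: "w \<ge> 0"
    by (simp add: w_def)
  have bound: "(real n)\<^sup>2 * (real \<Delta> - lambda1_max n \<Delta>) / D \<le> w / D * (1 / (1 - real a / real n))\<^sup>2"
    if n: "n > a" for n
  proof -
    \<comment> \<open>As many blocks as fit while one vertex is reserved for the tail.\<close>
    define m where "m = (n - K - 1) div (\<Delta> + 1)"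
    define q where "q = n - K - m * (\<Delta> + 1)"
    have split: "n - K - 1 = m * (\<Delta> + 1) + (n - K - 1) mod (\<Delta> + 1)"
      unfolding m_def by (simp only: div_mult_mod_eq)
    have "(n - K - 1) mod (\<Delta> + 1) < \<Delta> + 1"
      by simp
    then have le: "n - a \<le> m * (\<Delta> + 1)" and mult_less: "m * (\<Delta> + 1) < n - K"
      using split n unfolding a_def by linarith+
    have "0 < m"
      using le n by (cases m) auto
    moreover have "0 < q"
      using mult_less by (simp add: q_def)
    ultimately interpret capped_chain \<Delta> c K C m q
      by (rule chain)
    have "n = K + m * (\<Delta> + 1) + q"
      using mult_less by (simp add: q_def)
    then have "real \<Delta> - lambda1_max n \<Delta> \<le> \<epsilon>"
      using lambda1_max_ge_chain by simp
    also have "\<dots> \<le> w / (real (m * (\<Delta> + 1)))\<^sup>2"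
      using \<epsilon>_le by (simp only: w_def)
    also have "\<dots> \<le> w / (real n - real a)\<^sup>2"
    proof (rule divide_left_mono)
      have "real n - real a \<le> real (m * (\<Delta> + 1))"
        using le n by linarith
      then show "(real n - real a)\<^sup>2 \<le> (real (m * (\<Delta> + 1)))\<^sup>2"
        using n by (intro power_mono) auto
      show "0 < (real (m * (\<Delta> + 1)))\<^sup>2 * (real n - real a)\<^sup>2"
        using n \<open>0 < m\<close> by (intro mult_pos_pos zero_less_power) (simp_all only: of_nat_0_less_iff, auto)
    qed (rule w)
    finally have "(real n)\<^sup>2 * (real \<Delta> - lambda1_max n \<Delta>) / D \<le> (real n)\<^sup>2 * (w / (real n - real a)\<^sup>2) / D"
      using D by (intro divide_right_mono mult_left_mono) auto
    also have "\<dots> = w / D * (real n / (real n - real a))\<^sup>2"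
      by (simp add: power_divide mult.commute)
    also have "real n / (real n - real a) = 1 / (1 - real a / real n)"
      using n by (simp add: field_simps)
    finally show ?thesis .
  qed
  have "(\<lambda>n. w / D * (1 / (1 - real a / real n))\<^sup>2) \<longlonglongrightarrow> w / D * (1 / (1 - 0))\<^sup>2"
    by (intro tendsto_intros lim_const_over_n) auto
  then have "(\<lambda>n. ereal (w / D * (1 / (1 - real a / real n))\<^sup>2)) \<longlonglongrightarrow> ereal (w / D)"
    by simp
  then have "limsup (\<lambda>n. ereal (w / D * (1 / (1 - real a / real n))\<^sup>2)) = ereal (w / D)"
    by (intro lim_imp_Limsup) simp_all
  moreover have "limsup (\<lambda>n. ereal ((real n)\<^sup>2 * (real \<Delta> - lambda1_max n \<Delta>) / D))
      \<le> limsup (\<lambda>n. ereal (w / D * (1 / (1 - real a / real n))\<^sup>2))"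
    using bound by (intro Limsup_mono eventually_mono[OF eventually_gt_at_top[of a]]) simp
  ultimately show ?thesis
    by (simp add: w_def)
qed

text \<open>The complement of the odd cap is the path \<open>1 - 0 - 2\<close> together with the perfect matching
  \<open>3 - 4\<close>, \<open>5 - 6\<close>, and so on up to \<open>\<Delta> - (\<Delta> + 1)\<close>.\<close>

definition odd_cap_nonnbrs :: "nat \<Rightarrow> nat set" where
  "odd_cap_nonnbrs i =
    (if i = 0 then {0, 1, 2} else if i \<le> 2 then {i, 0} else {i, if odd i then i + 1 else i - 1})"

text \<open>The complement on \<open>\<Delta> + 2\<close> vertices needs degree 2 at the port 0 and
  degree 1 elsewhere; \<open>odd_cap_nonnbrs\<close> also counts the vertex itself.\<close>

lemma odd_cap:
  assumes "odd \<Delta>" "\<Delta> \<ge> 3" "0 < m" "0 < q"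
  shows "capped_chain \<Delta> 1 (\<Delta> + 2) (\<lambda>i. {..<\<Delta> + 2} - odd_cap_nonnbrs i) m q"
proof
  fix i assume i: "i < \<Delta> + 2"
  have "odd_cap_nonnbrs i \<subseteq> {..<\<Delta> + 2}"
  proof -
    \<comment> \<open>\<open>\<Delta> + 1\<close> is even, so an odd \<open>i\<close> is at most
      \<open>\<Delta>\<close> and its partner exists.\<close>
    have "i + 1 < \<Delta> + 2" if "odd i"
      using that i assms(1) by (metis Suc_eq_plus1 add_2_eq_Suc' even_Suc linorder_neqE_nat not_less_eq)
    then show ?thesis
      using i assms(2) by (auto simp: odd_cap_nonnbrs_def)
  qed
  moreover have "card (odd_cap_nonnbrs i) = (if i < 1 then 3 else 2)"
    by (auto simp: odd_cap_nonnbrs_def card_insert_if)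
  ultimately show "card ({..<\<Delta> + 2} - odd_cap_nonnbrs i) + (if i < 1 then 1 else 0) = \<Delta>"
    using assms(2) by (simp add: card_Diff_subset finite_subset)
  show "i \<notin> {..<\<Delta> + 2} - odd_cap_nonnbrs i"
    by (auto simp: odd_cap_nonnbrs_def)
  show "i \<in> {..<\<Delta> + 2} - odd_cap_nonnbrs j" if "j \<in> {..<\<Delta> + 2} - odd_cap_nonnbrs i" for j
    using that i by (auto simp: odd_cap_nonnbrs_def split: if_splits)
  define R where "R = {(i, j). i < \<Delta> + 2 \<and> j \<in> {..<\<Delta> + 2} - odd_cap_nonnbrs i}"
  have "(0, i) \<in> R" if "i > 2"
    using that i by (auto simp: R_def odd_cap_nonnbrs_def)
  moreover have "(0, 3) \<in> R" "(3, 1) \<in> R" "(3, 2) \<in> R"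
    using assms(2) by (auto simp: R_def odd_cap_nonnbrs_def)
  then have "(0, 1) \<in> R\<^sup>*" "(0, 2) \<in> R\<^sup>*"
    by (meson r_into_rtrancl rtrancl_into_rtrancl)+
  moreover consider "i = 0" | "i = 1" | "i = 2" | "i > 2"
    by linarith
  ultimately have "(0, i) \<in> R\<^sup>*"
    by cases auto
  then show "(0, i) \<in> {(i, j). i < \<Delta> + 2 \<and> j \<in> {..<\<Delta> + 2} - odd_cap_nonnbrs i}\<^sup>*"
    by (simp only: R_def)
qed (use assms in auto)

text \<open>The cap is a complete graph without the edge between its two ports; the edges into block
  0 restore their degrees.\<close>

lemma even_cap:
  assumes "\<Delta> \<ge> 3" "0 < m" "0 < q"
  shows "capped_chain \<Delta> 2 (\<Delta> + 1) (\<lambda>i. {..<\<Delta> + 1} - (if i < 2 then {0, 1} else {i})) m q"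
proof
  fix i assume i: "i < \<Delta> + 1"
  show "card ({..<\<Delta> + 1} - (if i < 2 then {0, 1} else {i})) + (if i < 2 then 1 else 0) = \<Delta>"
    using i assms(1) by (simp add: card_Diff_subset)
  show "i \<in> {..<\<Delta> + 1} - (if j < 2 then {0, 1} else {j})"
    if "j \<in> {..<\<Delta> + 1} - (if i < 2 then {0, 1} else {i})" for j
    using that i by (auto split: if_splits)
  define R where "R = {(i, j). i < \<Delta> + 1 \<and> j \<in> {..<\<Delta> + 1} - (if i < 2 then {0, 1} else {i})}"
  have "(0, i) \<in> R" if "i \<ge> 2"
    using that i by (auto simp: R_def)
  moreover have "(0, 2) \<in> R" "(2, 1) \<in> R"
    using assms(1) by (auto simp: R_def)
  then have "(0, 1) \<in> R\<^sup>*"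
    by (meson r_into_rtrancl rtrancl_into_rtrancl)
  moreover consider "i = 0" | "i = 1" | "i \<ge> 2"
    by linarith
  ultimately have "(0, i) \<in> R\<^sup>*"
    by cases auto
  then show "(0, i) \<in> {(i, j). i < \<Delta> + 1 \<and> j \<in> {..<\<Delta> + 1} - (if i < 2 then {0, 1} else {i})}\<^sup>*"
    by (simp only: R_def)
qed (use assms in auto)

theorem theorem6p2:
  fixes \<Delta> :: nat
  assumes "\<Delta> \<ge> 3"
  shows "(odd \<Delta> \<longrightarrow>
            limsup (\<lambda>n. ereal ((real n)\<^sup>2 * (real \<Delta> - lambda1_max n \<Delta>) / (real \<Delta> - 1)))
              \<le> ereal (pi\<^sup>2 / 4)) \<and>
         (even \<Delta> \<longrightarrow>
            limsup (\<lambda>n. ereal ((real n)\<^sup>2 * (real \<Delta> - lambda1_max n \<Delta>) / (real \<Delta> - 2)))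
              \<le> ereal (pi\<^sup>2 / 2))"
proof (intro conjI impI)
  assume "odd \<Delta>"
  \<comment> \<open>Here \<open>c = 1\<close>; in the even case \<open>c = 2\<close> doubles the
    constant.\<close>
  have eq: "pi\<^sup>2 / 4 * (real 1 * (real \<Delta> - real 1)) / (real \<Delta> - 1) = pi\<^sup>2 / 4"
    using assms by (simp add: field_simps)
  show "limsup (\<lambda>n. ereal ((real n)\<^sup>2 * (real \<Delta> - lambda1_max n \<Delta>) / (real \<Delta> - 1)))
      \<le> ereal (pi\<^sup>2 / 4)"
    using limsup_gap_le[OF odd_cap[OF \<open>odd \<Delta>\<close> assms], of "real \<Delta> - 1", unfolded eq] assms by simp
next
  have eq: "pi\<^sup>2 / 4 * (real 2 * (real \<Delta> - real 2)) / (real \<Delta> - 2) = pi\<^sup>2 / 2"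
    using assms by (simp add: field_simps)
  show "limsup (\<lambda>n. ereal ((real n)\<^sup>2 * (real \<Delta> - lambda1_max n \<Delta>) / (real \<Delta> - 2)))
      \<le> ereal (pi\<^sup>2 / 2)"
    using limsup_gap_le[OF even_cap[OF assms], of "real \<Delta> - 2", unfolded eq] assms by simp
qed

end
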